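(* Let $\boldsymbol{r}=(r_n)_{n=1}^\infty=(2,3,2,4,2,3,2,5,\ldots)$ be the sequence where $r_n$ is the number of divisors of $2n$ of the form $2^k$ with $k\ge0$. Let $\boldsymbol{a}=(2,3,4,5,6,\ldots)$, i.e. $a_n=n+1$ for $n\ge1$. Then $\alpha(\boldsymbol{a})=\boldsymbol{r}$, where $\alpha$ is the recursive transform defined in the context.
   Context: For a sequence $\boldsymbol{a}=(a_n)_{n=1}^\infty$ of integers, $\alpha(\boldsymbol{a})=\boldsymbol{b}=(b_n)_{n=1}^\infty$ is recursively defined by: (1) $b_1=a_1$, $b_2=a_2$; (2) for any $i\ge2$, let $j$ be the first index such that $b_j=a_i$; then $b_{j+k}=b_k$ for $k=1,2,\ldots,j-1$, and $b_{2j}=a_{i+1}$. Thus $\boldsymbol{b}=(a_1,a_2,a_1,a_3,a_1,a_2,a_1,a_4,\ldots)$; equivalently $b_{2^{t-1}(2k-1)}=a_t$ for all $t,k\ge1$. *)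

theory Defs
  imports Complex_Main
begin

text \<open>A sequence \<open>(a\<^sub>n)\<close>, \<open>n \<ge> 1\<close>, of integers is a function \<open>nat \<Rightarrow> int\<close> whose value at index 0
  is irrelevant.\<close>

text \<open>The recursive clauses that determine \<open>b = \<alpha>(a)\<close>; \<open>j\<close> is the first index with
  \<open>b j = a i\<close>.  If \<open>a\<close> has repeated terms these clauses need not determine \<open>b\<close>.\<close>

definition is_alpha :: "(nat \<Rightarrow> int) \<Rightarrow> (nat \<Rightarrow> int) \<Rightarrow> bool" where
  "is_alpha a b \<longleftrightarrow>
     b 1 = a 1 \<and> b 2 = a 2 \<and>
     (\<forall>i\<ge>2. \<exists>j\<ge>1. b j = a i \<and> (\<forall>m. 1 \<le> m \<and> m < j \<longrightarrow> b m \<noteq> a i) \<and>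
        (\<forall>k. 1 \<le> k \<and> k \<le> j - 1 \<longrightarrow> b (j + k) = b k) \<and>
        b (2 * j) = a (i + 1))"

text \<open>The condition \<open>b 0 = 0\<close> only normalises the irrelevant value, so that the description
  can be unique.\<close>

definition alpha :: "(nat \<Rightarrow> int) \<Rightarrow> (nat \<Rightarrow> int)" where
  "alpha a = (THE b. b 0 = 0 \<and> is_alpha a b)"

definition r :: "nat \<Rightarrow> int" where
  "r n = int (card {d. d dvd 2 * n \<and> (\<exists>k. d = 2 ^ k)})"

end

theory Submission
  imports Defs
begin

text \<open>The sequence \<open>r\<close> satisfies \<open>r (2^t) = t + 2\<close>, \<open>r k < t + 2\<close> and \<open>r (2^t + k) = r k\<close> for
  \<open>1 \<le> k < 2^t\<close>. So the first occurrence of \<open>a i = i + 1\<close> in \<open>r\<close> is at \<open>2^(i - 1)\<close>, which gives the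
  recursive clauses. Conversely, once a solution agrees with \<open>r\<close> up to \<open>2^t\<close>, its clause for
  \<open>i = t + 1\<close> must use \<open>j = 2^t\<close>, and this determines the solution up to \<open>2^(t + 1)\<close>.\<close>

text \<open>Every power of two divides 0, so the set being counted is infinite and
  \<open>card\<close> defaults to 0. This matches the normalisation \<open>b 0 = 0\<close> in
  \<open>alpha\<close>.\<close>

lemma r_zero: "r 0 = 0"
proof -
  have "inj ((^) (2::nat))"
    by (simp add: inj_on_def)
  then have "infinite (range ((^) (2::nat)))"
    by (simp add: finite_image_iff)
  moreover have "{d::nat. \<exists>k. d = 2 ^ k} = range ((^) 2)"
    by auto
  ultimately show ?thesis
    by (simp add: r_def)
qed

lemma r_power_two: "r (2 ^ t) = int t + 2"
proof -
  have "{d::nat. d dvd 2 * 2 ^ t \<and> (\<exists>k. d = 2 ^ k)} = (^) 2 ` {..Suc t}"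
    by (auto simp: dvd_power_iff_le simp flip: power_Suc)
  moreover have "card ((^) (2::nat) ` {..Suc t}) = t + 2"
    by (subst card_image) (auto simp: inj_on_def)
  ultimately show ?thesis
    by (simp add: r_def)
qed

lemma two_power_dvd_double_le:
  fixes k :: nat
  assumes "2 ^ e dvd 2 * k" "0 < k" "k < 2 ^ t"
  shows "e \<le> t"
proof -
  have "2 ^ e \<le> 2 * k"
    using assms by (intro dvd_imp_le) auto
  also have "\<dots> < 2 ^ Suc t"
    using assms by simp
  finally show ?thesis
    by (metis less_Suc_eq_le one_less_numeral_iff power_less_imp_less_exp semiring_norm(76))
qed

text \<open>Only the exponents 0, ..., t can occur, so there are at most t + 1 such
  divisors.\<close>

lemma r_less:
  assumes "0 < k" "k < 2 ^ t"
  shows "r k < int t + 2"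
proof -
  have "{d. d dvd 2 * k \<and> (\<exists>e. d = 2 ^ e)} \<subseteq> (^) 2 ` {..t}"
    using two_power_dvd_double_le[OF _ assms] by auto
  then have "card {d. d dvd 2 * k \<and> (\<exists>e. d = 2 ^ e)} \<le> card {..t}"
    by (meson card_image_le card_mono finite_atMost finite_imageI le_trans)
  then show ?thesis
    by (simp add: r_def)
qed

text \<open>A power of two dividing 2k or 2(2^t + k) has exponent at most t + 1. It therefore
  divides the difference 2^(t + 1) of these numbers, and hence both of them.\<close>

lemma r_shift:
  assumes "0 < k" "k < 2 ^ t"
  shows "r (2 ^ t + k) = r k"
proof -
  have "2 ^ e dvd 2 * (2 ^ t + k) \<longleftrightarrow> 2 ^ e dvd 2 * k" for e :: nat
  proof -
    have "(2::nat) ^ e dvd 2 ^ Suc t" if "e \<le> Suc t"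
      using that by (rule le_imp_power_dvd)
    moreover have "e \<le> Suc t" if "2 ^ e dvd 2 * k"
      using two_power_dvd_double_le[OF that assms] by simp
    \<comment> \<open>Here 2^t + k lies below 2^(t + 1), so the exponent bound is taken at
      \<open>Suc t\<close>.\<close>
    moreover have "e \<le> Suc t" if "2 ^ e dvd 2 * (2 ^ t + k)"
      using two_power_dvd_double_le[OF that, of "Suc t"] assms by simp
    ultimately show ?thesis
      by (metis add_mult_distrib2 dvd_add_right_iff power_Suc)
  qed
  then have "{d. d dvd 2 * (2 ^ t + k) \<and> (\<exists>e. d = 2 ^ e)} = {d. d dvd 2 * k \<and> (\<exists>e. d = 2 ^ e)}"
    by auto
  then show ?thesis
    by (simp only: r_def)
qed

lemma is_alpha_r:
  assumes a: "\<forall>n\<ge>1. a n = int n + 1"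
  shows "is_alpha a r"
  unfolding is_alpha_def
proof (intro conjI allI impI)
  show "r 1 = a 1" "r 2 = a 2"
    using r_power_two[of 0] r_power_two[of 1] a by simp_all
next
  fix i :: nat
  assume "2 \<le> i"
  then obtain t where i: "i = Suc t"
    by (cases i) auto
  have "r (2 ^ t) = a i" "r (2 * 2 ^ t) = a (i + 1)"
    using a i r_power_two[of t] r_power_two[of i] by simp_all
  moreover have "r m \<noteq> a i" if "1 \<le> m \<and> m < 2 ^ t" for m
    using r_less[of m t] that a i by auto
  moreover have "r (2 ^ t + k) = r k" if "1 \<le> k \<and> k \<le> 2 ^ t - 1" for k
    using that by (intro r_shift) auto
  ultimately show "\<exists>j\<ge>1. r j = a i \<and> (\<forall>m. 1 \<le> m \<and> m < j \<longrightarrow> r m \<noteq> a i) \<and>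
      (\<forall>k. 1 \<le> k \<and> k \<le> j - 1 \<longrightarrow> r (j + k) = r k) \<and> r (2 * j) = a (i + 1)"
    by (intro exI[of _ "2 ^ t"]) auto
qed

text \<open>With the bound \<open>2 ^ Suc t\<close>, the base case consists of exactly the two
  prescribed initial values; each induction step doubles the range.\<close>

lemma is_alpha_eq_r_upto:
  assumes a: "\<forall>n\<ge>1. a n = int n + 1" and b: "is_alpha a b"
    and "1 \<le> n" "n \<le> 2 ^ Suc t"
  shows "b n = r n"
  using assms(3,4)
proof (induction t arbitrary: n)
  case 0
  then have "n = 1 \<or> n = 2"
    by auto
  then show ?case
    using a b is_alpha_r[OF a] by (auto simp: is_alpha_def)
next
  case (Suc t)
  define p :: nat where "p = 2 ^ Suc t"
  have p: "1 \<le> p"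
    by (simp add: p_def)
  have IH: "b m = r m" if "1 \<le> m" "m \<le> p" for m
    using Suc.IH that by (simp add: p_def)
  \<comment> \<open>Both sides are t + 3, so the clause for i = t + 2 is the one that extends
    \<open>b\<close> beyond \<open>p\<close>.\<close>
  have a_p: "a (Suc (Suc t)) = r p"
    using a r_power_two[of "Suc t"] by (simp add: p_def)
  have "2 \<le> Suc (Suc t)"
    by simp
  then obtain j where j: "1 \<le> j" "b j = r p"
    and first: "\<And>m. 1 \<le> m \<Longrightarrow> m < j \<Longrightarrow> b m \<noteq> r p"
    and shift: "\<And>k. 1 \<le> k \<Longrightarrow> k \<le> j - 1 \<Longrightarrow> b (j + k) = b k"
    and double: "b (2 * j) = a (Suc (Suc t) + 1)"
    using b a_p unfolding is_alpha_def by metis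
  \<comment> \<open>If p < j, then b p = r p would be an earlier occurrence; if j < p, then b j = r
    j < r p.\<close>
  have "\<not> p < j"
    using first[of p] IH[of p] p by auto
  moreover have "\<not> j < p"
    using j IH[of j] r_less[of j "Suc t"] r_power_two[of "Suc t"] by (auto simp: p_def)
  ultimately have "j = p"
    by simp
  \<comment> \<open>The three ranges are settled by the induction hypothesis, the copying clause and
    the doubling clause.\<close>
  consider "n \<le> p" | k where "n = p + k" "1 \<le> k" "k < p" | "n = 2 * p"
  proof -
    have "n \<le> 2 * p"
      using Suc.prems by (simp add: p_def)
    then show thesis
      using that(1,3) that(2)[of "n - p"] by linarith
  qed
  then show ?case
  proof cases
    case 1
    then show ?thesis
      using IH Suc.prems by simp
  next
    case 2
    then have "b n = r k"
      using shift[of k] IH[of k] \<open>j = p\<close> by simp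
    then show ?thesis
      using 2 r_shift[of k "Suc t"] by (simp add: p_def)
  next
    case 3
    then show ?thesis
      using double \<open>j = p\<close> a r_power_two[of "Suc (Suc t)"] by (simp add: p_def)
  qed
qed

lemma is_alpha_unique:
  assumes "\<forall>n\<ge>1. a n = int n + 1" "is_alpha a b" "b 0 = 0"
  shows "b = r"
proof
  fix n :: nat
  \<comment> \<open>Any t with n \<le> 2^(t + 1) would serve; t = n is a convenient choice.\<close>
  have "n < 2 ^ n"
    by (rule less_exp)
  then have "n \<le> 2 ^ Suc n"
    unfolding power_Suc by linarith
  then show "b n = r n"
    using is_alpha_eq_r_upto[OF assms(1,2), of n n] assms(3) r_zero by (cases "n = 0") auto
qed

theorem proposition3:
  fixes a :: "nat \<Rightarrow> int"
  assumes "\<forall>n\<ge>1. a n = int n + 1"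
  shows "(\<exists>!b. b 0 = 0 \<and> is_alpha a b) \<and> (\<forall>n\<ge>1. alpha a n = r n)"
proof -
  have r: "r 0 = 0 \<and> is_alpha a r"
    using r_zero is_alpha_r[OF assms] by simp
  have unique: "b = r" if "b 0 = 0 \<and> is_alpha a b" for b
    using is_alpha_unique[OF assms] that by blast
  have "alpha a = r"
    unfolding alpha_def using r unique by (rule the_equality)
  with r unique show ?thesis
    by auto
qed

end
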